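(* There exists an absolute constant $c>0$ such that $\pi(\mathcal{D}_r^2) \geq c/r$ for all integers $r\ge 2$ (that is, $\pi(\mathcal{D}_r^2)=\Omega(1/r)$). Furthermore, there exists an absolute constant $C>0$ such that for each integer $t \geq 3$ and every integer $r\ge t$, $$\pi(\mathcal{D}_r^t) \geq r^{-\frac{4t-2}{\binom{2t}{t}-1}-\frac{C}{\sqrt{\log r}}}$$ (that is, $\pi(\mathcal{D}_r^t) \geq r^{-\frac{4t-2}{\binom{2t}{t}-1}-O(1/\sqrt{\log r})}$).
   Context: For integers $t\ge 2$ and $r\ge t$, an $r$-uniform $t$-daisy $\mathcal{D}_r^t$ is a family of $\binom{2t}{t}$ $r$-element sets of the form $\{S\cup T : T\subset U,\ |T|=t\}$ for some sets $S,U$ with $|S|=r-t$, $|U|=2t$ and $S\cap U=\emptyset$. A family of $r$-element subsets of $[n]=\{1,2,\ldots,n\}$ is $\mathcal{D}_r^t$-free if it contains no $r$-uniform $t$-daisy as a subfamily. $\mathrm{ex}(n,\mathcal{D}_r^t)$ denotes the maximum possible cardinality of a $\mathcal{D}_r^t$-free family of $r$-element subsets of $[n]$, and the Turán density is $\pi(\mathcal{D}_r^t)=\lim_{n\to\infty}\mathrm{ex}(n,\mathcal{D}_r^t)/\binom{n}{r}$. Here $\log$ denotes the natural logarithm. The notation $f=O(h)$ means that there is an absolute constant $C>0$ with $f\le Ch$ throughout the domain. *)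

theory Defs
  imports "HOL-Analysis.Analysis"
begin

definition is_daisy :: "nat \<Rightarrow> nat \<Rightarrow> 'a set set \<Rightarrow> bool" where
  "is_daisy r t D \<longleftrightarrow>
     (\<exists>S U. finite S \<and> finite U \<and> card S = r - t \<and> card U = 2 * t \<and> S \<inter> U = {} \<and>
            D = {S \<union> T |T. T \<subseteq> U \<and> card T = t})"

definition daisy_free :: "nat \<Rightarrow> nat \<Rightarrow> 'a set set \<Rightarrow> bool" where
  "daisy_free r t F \<longleftrightarrow> \<not> (\<exists>D. is_daisy r t D \<and> D \<subseteq> F)"

definition ex_daisy :: "nat \<Rightarrow> nat \<Rightarrow> nat \<Rightarrow> nat" where
  "ex_daisy n r t =
     Max {card F |F. F \<subseteq> {A. A \<subseteq> {1..n} \<and> card A = r} \<and> daisy_free r t F}"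

(* The quotient is 0 / 0 = 0 for n < r, which does not affect the limit. For r \<ge> t \<ge> 1 the
   quotients are nonincreasing for n \<ge> r by averaging, so the limit exists. *)
definition daisy_turan_density :: "nat \<Rightarrow> nat \<Rightarrow> real" where
  "daisy_turan_density r t = lim (\<lambda>n. real (ex_daisy n r t) / real (n choose r))"

end

theory Submission
  imports Defs "HOL-Library.Z2" "HOL-Library.Function_Algebras"
begin

text \<open>Both bounds follow from a uniform one: the density is at least \<open>1/4\<close> whenever
  \<open>2 \<le> t \<le> r\<close>. Indeed \<open>1/4\<close> exceeds \<open>c / r\<close> for \<open>c = 1/4\<close>, and for \<open>r \<ge> 3\<close> the factor
  \<open>r powr (- C / sqrt (ln r)) = exp (- C * sqrt (ln r))\<close> is already below \<open>1/4\<close> when \<open>C = 2\<close>,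
  so the polynomial factor in \<open>r\<close> can be discarded.

  The uniform bound comes from linear algebra over the field with two elements. Label the points
  of \<open>{1..n}\<close> by vectors of an \<open>r\<close>-dimensional space over this field and keep those \<open>r\<close>-sets whose
  labels form a basis. Suppose that the kept family contained a daisy with kernel \<open>S\<close> and petals in
  \<open>U\<close>. Fix a \<open>t\<close>-set \<open>T\<close> in \<open>U\<close>, so that \<open>S \<union> T\<close> is a basis, and let \<open>u\<close>, \<open>v\<close> be two points of
  \<open>U - T\<close>. As \<open>u\<close> can be exchanged with any point of \<open>T\<close>, the expansion of \<open>u\<close> in this basis uses
  every element of \<open>T\<close>, with the only nonzero coefficient there is; the same holds for \<open>v\<close>. Hence
  the difference of \<open>u\<close> and \<open>v\<close> lies in the span of \<open>S\<close>, although some member of the daisy contains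
  \<open>S\<close>, \<open>u\<close> and \<open>v\<close> (\<open>daisy_free_labelled_bases\<close>).

  For a uniformly random labelling an \<open>r\<close>-set is a basis with probability
  \<open>(1 - 1/2) * (1 - 1/4) * \<dots> * (1 - 1/2 ^ r) \<ge> 1/4\<close> (\<open>card_independent_labellings_ge\<close>,
  \<open>prod_one_minus_half_powers_ge\<close>), so some labelling keeps at least a quarter of all \<open>r\<close>-sets, for
  every \<open>n\<close>. This passes to the limit, which exists because the quotients decrease
  (\<open>ex_daisy_Suc_le\<close>).\<close>

section \<open>Monotonicity of the extremal quotients\<close>

lemma daisy_support_subset:
  assumes "t \<ge> 1" "finite U" "card U = 2 * t"
    and sub: "{S \<union> T |T. T \<subseteq> U \<and> card T = t} \<subseteq> {A. A \<subseteq> X}"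
  shows "S \<union> U \<subseteq> X"
proof
  fix x assume x: "x \<in> S \<union> U"
  have "\<exists>T. T \<subseteq> U \<and> card T = t \<and> (x \<in> U \<longrightarrow> x \<in> T)"
  proof (cases "x \<in> U")
    case True
    have "t - 1 \<le> card (U - {x})" using assms True by simp
    then obtain T where T: "T \<subseteq> U - {x}" "card T = t - 1" "finite T"
      by (meson obtain_subset_with_card_n)
    then have "card (insert x T) = t" using assms by (subst card_insert_disjoint) auto
    then show ?thesis using T True by (intro exI[of _ "insert x T"]) auto
  next
    case False
    then show ?thesis using obtain_subset_with_card_n[of t U] assms by (metis le_add2 mult_2)
  qed
  then show "x \<in> X" using sub x by auto
qed

text \<open>The extremal number depends on the ground set only through its size. A daisy is transported
  back along a bijection, which needs its kernel and its petals to lie inside the ground set.\<close>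

lemma card_le_ex_daisy:
  assumes t: "t \<ge> 1" and X: "finite X"
    and F: "F \<subseteq> {A. A \<subseteq> X \<and> card A = r}" and free: "daisy_free r t F"
  shows "card F \<le> ex_daisy (card X) r t"
proof -
  define n where "n = card X"
  obtain h where h: "bij_betw h X {1..n}"
    using bij_betw_iff_card[of X "{1..n}"] X by (auto simp: n_def)
  define g where "g = inv_into X h"
  have g: "bij_betw g {1..n} X" unfolding g_def using h by (rule bij_betw_inv_into)
  have gh: "g ` h ` A = A" if "A \<subseteq> X" for A
    unfolding g_def by (rule inv_into_image_cancel[OF bij_betw_imp_inj_on[OF h] that])
  define G where "G = (\<lambda>A. h ` A) ` F"
  have inj: "inj_on (\<lambda>A. h ` A) F"
    by (rule inj_on_inverseI[where g = "\<lambda>A. g ` A"]) (use gh F in auto)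
  have cardG: "card G = card F" unfolding G_def by (rule card_image[OF inj])
  have GX: "G \<subseteq> {A. A \<subseteq> {1..n} \<and> card A = r}"
  proof
    fix B assume "B \<in> G"
    then obtain A where A: "A \<in> F" "B = h ` A" unfolding G_def by auto
    then have AX: "A \<subseteq> X" "card A = r" using F by auto
    have "inj_on h A" by (rule inj_on_subset[OF bij_betw_imp_inj_on[OF h] AX(1)])
    then have "card B = r" using card_image[of h A] A AX by simp
    moreover have "B \<subseteq> {1..n}" using A AX h by (auto simp: bij_betw_def)
    ultimately show "B \<in> {A. A \<subseteq> {1..n} \<and> card A = r}" by simp
  qed
  have "daisy_free r t G"
    unfolding daisy_free_def
  proof
    assume "\<exists>D. is_daisy r t D \<and> D \<subseteq> G"
    then obtain S U where SU: "finite S" "finite U" "card S = r - t" "card U = 2 * t"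
      "S \<inter> U = {}" and D: "{S \<union> T |T. T \<subseteq> U \<and> card T = t} \<subseteq> G"
      unfolding is_daisy_def by auto
    have SUn: "S \<union> U \<subseteq> {1..n}"
      by (rule daisy_support_subset[OF t SU(2,4)], rule subset_trans[OF D]) (use GX in auto)
    have injg: "inj_on g (S \<union> U)" by (rule inj_on_subset[OF bij_betw_imp_inj_on[OF g] SUn])
    have cards: "card (g ` S) = r - t" "card (g ` U) = 2 * t"
      using card_image[of g S] card_image[of g U] injg SU(3,4) by (simp_all add: inj_on_Un)
    have disj: "g ` S \<inter> g ` U = {}"
      using inj_on_image_Int[OF injg, of S U] SU(5) by simp
    have "{g ` S \<union> T |T. T \<subseteq> g ` U \<and> card T = t} \<subseteq> F"
    proof
      fix B assume "B \<in> {g ` S \<union> T |T. T \<subseteq> g ` U \<and> card T = t}"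
      then obtain T where T: "B = g ` S \<union> T" "T \<subseteq> g ` U" "card T = t" by blast
      obtain T' where T': "T' \<subseteq> U" "T = g ` T'" using T(2) by (rule subset_imageE)
      have "inj_on g T'" using T'(1) by (intro inj_on_subset[OF injg]) auto
      then have "card T' = t" using card_image[of g T'] T(3) T'(2) by simp
      then have "S \<union> T' \<in> G" using T'(1) by (intro subsetD[OF D] CollectI exI[of _ T']) simp
      then obtain A where A: "A \<in> F" "S \<union> T' = h ` A" unfolding G_def by (rule imageE)
      have "B = g ` (S \<union> T')" using T(1) T'(2) by (simp add: image_Un)
      also have "\<dots> = g ` h ` A" using A(2) by simp
      also have "\<dots> = A" using A(1) F by (intro gh) auto
      finally show "B \<in> F" using A by simp
    qed
    moreover have "is_daisy r t {g ` S \<union> T |T. T \<subseteq> g ` U \<and> card T = t}"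
      unfolding is_daisy_def using cards disj SU(1,2)
      by (intro exI[of _ "g ` S"] exI[of _ "g ` U"] conjI finite_imageI refl) simp_all
    ultimately show False using free unfolding daisy_free_def by (meson exI)
  qed
  then have "card G \<in> {card F |F. F \<subseteq> {A. A \<subseteq> {1..n} \<and> card A = r} \<and> daisy_free r t F}"
    using GX by (intro CollectI exI[of _ G] conjI refl)
  then have "card G \<le> ex_daisy n r t"
    unfolding ex_daisy_def by (rule Max_ge[rotated]) simp
  then show ?thesis using cardG n_def by simp
qed

lemma ex_daisy_attained:
  obtains F where "F \<subseteq> {A. A \<subseteq> {1..n} \<and> card A = r}" "daisy_free r t (F :: nat set set)"
    "card F = ex_daisy n r t"
proof -
  have "daisy_free r t ({} :: nat set set)"
    unfolding daisy_free_def is_daisy_def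
  proof clarsimp
    fix U :: "nat set" assume "finite U" "card U = 2 * t"
    then show "\<exists>T\<subseteq>U. card T = t" using obtain_subset_with_card_n[of t U] by (metis le_add2 mult_2)
  qed
  then have ne: "{card F |F. F \<subseteq> {A. A \<subseteq> {1..n} \<and> card A = r} \<and> daisy_free r t F} \<noteq> {}"
    by blast
  have "finite {card F |F. F \<subseteq> {A. A \<subseteq> {1..n} \<and> card A = r} \<and> daisy_free r t F}"
    by simp
  from Max_in[OF this ne] show ?thesis unfolding ex_daisy_def[symmetric] using that by auto
qed

text \<open>Double counting of the pairs of a member of an optimal family and a point outside it: deleting
  a point leaves a daisy-free family on one point fewer.\<close>

lemma ex_daisy_Suc_le:
  assumes t: "t \<ge> 1"
  shows "ex_daisy (Suc n) r t * (Suc n - r) \<le> Suc n * ex_daisy n r t"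
proof -
  obtain F where F: "F \<subseteq> {A. A \<subseteq> {1..Suc n} \<and> card A = r}" "daisy_free r t F"
    "card F = ex_daisy (Suc n) r t" by (rule ex_daisy_attained)
  have finF: "finite F" by (rule finite_subset[OF F(1)]) simp
  have "ex_daisy (Suc n) r t * (Suc n - r) = (\<Sum>A\<in>F. card {x \<in> {1..Suc n}. x \<notin> A})"
  proof -
    have "card {x \<in> {1..Suc n}. x \<notin> A} = Suc n - r" if "A \<in> F" for A
    proof -
      have A: "A \<subseteq> {1..Suc n}" "card A = r" using F that by auto
      then have "finite A" using finite_subset by blast
      moreover have "{x \<in> {1..Suc n}. x \<notin> A} = {1..Suc n} - A" by auto
      ultimately show ?thesis using A by (simp add: card_Diff_subset)
    qed
    then show ?thesis using F(3) by simp
  qed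
  also have "\<dots> = (\<Sum>x\<in>{1..Suc n}. card {A \<in> F. x \<notin> A})"
    by (rule sum_multicount_gen[symmetric]) (use finF in auto)
  also have "\<dots> \<le> (\<Sum>x\<in>{1..Suc n}. ex_daisy n r t)"
  proof (rule sum_mono)
    fix x assume x: "x \<in> {1..Suc n}"
    have "card {A \<in> F. x \<notin> A} \<le> ex_daisy (card ({1..Suc n} - {x})) r t"
    proof (rule card_le_ex_daisy[OF t])
      show "{A \<in> F. x \<notin> A} \<subseteq> {A. A \<subseteq> {1..Suc n} - {x} \<and> card A = r}" using F(1) by auto
      show "daisy_free r t {A \<in> F. x \<notin> A}" using F(2) unfolding daisy_free_def by auto
    qed simp
    then show "card {A \<in> F. x \<notin> A} \<le> ex_daisy n r t" using x by simp
  qed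
  finally show ?thesis by simp
qed

lemma daisy_turan_density_ge:
  assumes t: "t \<ge> 1"
    and lower: "\<And>n. n \<ge> r \<Longrightarrow> c * real (n choose r) \<le> real (ex_daisy n r t)"
  shows "c \<le> daisy_turan_density r t"
proof -
  define a where "a n = real (ex_daisy n r t) / real (n choose r)" for n
  have step: "a (Suc n) \<le> a n" if n: "n \<ge> r" for n
  proof -
    have choose: "real (Suc n choose r) * (Suc n - r) = Suc n * real (n choose r)"
      using binomial_absorb_comp[of "Suc n" r] by (metis diff_Suc_1 mult.commute of_nat_mult)
    have "real (ex_daisy (Suc n) r t) * (Suc n - r) \<le> Suc n * real (ex_daisy n r t)"
      using ex_daisy_Suc_le[OF t, of n r] by (metis of_nat_le_iff of_nat_mult)
    then have "real (ex_daisy (Suc n) r t) * (Suc n - r) * real (n choose r)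
        \<le> Suc n * real (ex_daisy n r t) * real (n choose r)"
      by (rule mult_right_mono) simp
    also have "\<dots> = real (ex_daisy n r t) * real (Suc n choose r) * (Suc n - r)"
      using choose by (simp add: mult_ac)
    finally have "real (ex_daisy (Suc n) r t) * real (n choose r)
        \<le> real (ex_daisy n r t) * real (Suc n choose r)"
      using n by (simp add: mult_ac)
    then show ?thesis
      unfolding a_def using n by (intro divide_le_eq[THEN iffD2]) (auto simp: field_simps)
  qed
  have "decseq (\<lambda>n. a (n + r))" by (rule decseq_SucI) (simp add: step)
  then obtain L where "(\<lambda>n. a (n + r)) \<longlonglongrightarrow> L"
    by (rule decseq_convergent[where B = 0]) (simp add: a_def)
  then have L: "a \<longlonglongrightarrow> L" by (rule LIMSEQ_offset)
  have "c \<le> a n" if "n \<ge> r" for n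
    using lower[OF that] that by (simp add: a_def le_divide_eq)
  then have "c \<le> L" using L by (intro LIMSEQ_le_const) auto
  moreover have "daisy_turan_density r t = L"
    using limI[OF L] unfolding daisy_turan_density_def a_def .
  ultimately show ?thesis by simp
qed

section \<open>Linear independence over the field with two elements\<close>

text \<open>Linear independence of the family \<open>f\<close> indexed by a finite set \<open>A\<close>: over two elements a linear
  combination is the sum over a subset, so no notion of coefficients is needed.\<close>

definition independent2 :: "('a \<Rightarrow> nat \<Rightarrow> bit) \<Rightarrow> 'a set \<Rightarrow> bool" where
  "independent2 f A \<longleftrightarrow> (\<forall>B\<subseteq>A. sum f B = 0 \<longrightarrow> B = {})"

definition bit_vectors :: "nat \<Rightarrow> (nat \<Rightarrow> bit) set" where
  "bit_vectors r = {x. \<forall>i\<ge>r. x i = 0}"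

lemma bit_vector_add_self: "x + x = (0 :: nat \<Rightarrow> bit)"
  by (rule ext) (simp add: plus_fun_def zero_fun_def)

lemma bit_vector_add_eq_0_iff: "x + y = 0 \<longleftrightarrow> x = (y :: nat \<Rightarrow> bit)"
  by (metis add.assoc add.right_neutral bit_vector_add_self add_0)

lemma card_bit_vectors: "card (bit_vectors r) = 2 ^ r" and finite_bit_vectors: "finite (bit_vectors r)"
proof -
  define \<phi> where "\<phi> I = (\<lambda>i. if i \<in> I then 1 else 0 :: bit)" for I :: "nat set"
  have "bij_betw \<phi> (Pow {..<r}) (bit_vectors r)"
  proof (rule bij_betwI[where g = "\<lambda>x. {i. x i \<noteq> 0}"])
    show "\<phi> \<in> Pow {..<r} \<rightarrow> bit_vectors r" by (auto simp: \<phi>_def bit_vectors_def)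
    show "(\<lambda>x. {i. x i \<noteq> 0}) \<in> bit_vectors r \<rightarrow> Pow {..<r}"
      by (force simp: bit_vectors_def not_le[symmetric])
    show "{i. \<phi> I i \<noteq> 0} = I" for I by (simp add: \<phi>_def)
    show "\<phi> {i. x i \<noteq> 0} = x" for x by (rule ext) (auto simp: \<phi>_def)
  qed
  then show "card (bit_vectors r) = 2 ^ r" "finite (bit_vectors r)"
    using bij_betw_same_card bij_betw_finite by (force simp: card_Pow)+
qed

lemma sum_in_bit_vectors:
  assumes "\<And>x. x \<in> B \<Longrightarrow> f x \<in> bit_vectors r"
  shows "sum f B \<in> bit_vectors r"
  using assms by (induction B rule: infinite_finite_induct)
    (auto simp: bit_vectors_def plus_fun_def zero_fun_def)

lemma sum_sym_diff:
  fixes f :: "'a \<Rightarrow> nat \<Rightarrow> bit"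
  assumes "finite B" "finite C"
  shows "sum f (sym_diff B C) = sum f B + sum f C"
proof -
  have "sum f B = sum f (B - C) + sum f (B \<inter> C)" "sum f C = sum f (C - B) + sum f (B \<inter> C)"
    using assms by (metis add.commute sum.Int_Diff, metis Int_commute add.commute sum.Int_Diff assms(2))
  then have "sum f B + sum f C = sum f (B - C) + sum f (C - B) + (sum f (B \<inter> C) + sum f (B \<inter> C))"
    by (simp add: add_ac)
  also have "\<dots> = sum f (sym_diff B C)"
    using assms by (subst sum.union_disjoint) (auto simp: bit_vector_add_self)
  finally show ?thesis by simp
qed

lemma independent2_sum_inj:
  assumes "independent2 f A" "finite A"
  shows "inj_on (sum f) (Pow A)"
proof (rule inj_onI)
  fix B C assume BC: "B \<in> Pow A" "C \<in> Pow A" "sum f B = sum f C"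
  then have "finite B" "finite C" using assms finite_subset by auto
  then have "sum f (sym_diff B C) = 0" using BC by (simp add: sum_sym_diff bit_vector_add_self)
  moreover have "sym_diff B C \<subseteq> A" using BC by auto
  ultimately have "sym_diff B C = {}" using assms(1) unfolding independent2_def by blast
  then show "B = C" by blast
qed

text \<open>An independent family of \<open>r\<close> vectors spans, since its \<open>2 ^ r\<close> subset sums are distinct.\<close>

lemma independent2_spans:
  assumes "independent2 f A" "finite A" "card A = r" "f ` A \<subseteq> bit_vectors r"
    and "v \<in> bit_vectors r"
  obtains B where "B \<subseteq> A" "sum f B = v"
proof -
  have "sum f ` Pow A = bit_vectors r"
  proof (rule card_subset_eq[OF finite_bit_vectors])
    show "sum f ` Pow A \<subseteq> bit_vectors r" using assms by (auto intro!: sum_in_bit_vectors)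
    show "card (sum f ` Pow A) = card (bit_vectors r)"
      using card_image[OF independent2_sum_inj[OF assms(1,2)]] assms
      by (simp add: card_Pow card_bit_vectors)
  qed
  then show ?thesis using assms(5) that by (metis PowD imageE)
qed

text \<open>A daisy of bases would give \<open>2 * t\<close> vectors in \<open>t\<close> dimensions of which any \<open>t\<close> are
  independent. Relative to the basis formed by \<open>t\<close> of them, each of the others has all coordinates
  equal to \<open>1\<close>, so two further vectors coincide; here all this takes place modulo the span of \<open>S\<close>.\<close>

lemma daisy_free_labelled_bases:
  assumes t: "2 \<le> t" "t \<le> r" and f: "\<And>x. x \<in> X \<Longrightarrow> f x \<in> bit_vectors r"
  shows "daisy_free r t {A. A \<subseteq> X \<and> card A = r \<and> independent2 f A}"
  unfolding daisy_free_def
proof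
  assume "\<exists>D. is_daisy r t D \<and> D \<subseteq> {A. A \<subseteq> X \<and> card A = r \<and> independent2 f A}"
  then obtain S U where SU: "finite S" "finite U" "card S = r - t" "card U = 2 * t" "S \<inter> U = {}"
    and D: "{S \<union> T |T. T \<subseteq> U \<and> card T = t} \<subseteq> {A. A \<subseteq> X \<and> card A = r \<and> independent2 f A}"
    unfolding is_daisy_def by auto
  have ind: "independent2 f (S \<union> T)" if "T \<subseteq> U" "card T = t" for T
    using D that by blast
  have SUX: "S \<union> U \<subseteq> X" by (rule daisy_support_subset[OF _ SU(2,4)]) (use D t in auto)
  have "t \<le> card U" using SU by simp
  then obtain T where T: "T \<subseteq> U" "card T = t" "finite T" by (meson obtain_subset_with_card_n)
  have "card (U - T) = t" using T SU by (simp add: card_Diff_subset)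
  then have "2 \<le> card (U - T)" using t by simp
  then obtain W where "W \<subseteq> U - T" "card W = 2" by (meson obtain_subset_with_card_n)
  then obtain u v where uv: "u \<in> U - T" "v \<in> U - T" "u \<noteq> v" by (auto simp: card_2_iff)
  have expand: "\<exists>B. T \<subseteq> B \<and> B \<subseteq> S \<union> T \<and> sum f B = f w" if w: "w \<in> U - T" for w
  proof -
    have "card (S \<union> T) = r" "f ` (S \<union> T) \<subseteq> bit_vectors r" "f w \<in> bit_vectors r"
      using D T f SUX w by auto
    then obtain B where B: "B \<subseteq> S \<union> T" "sum f B = f w"
      using independent2_spans[OF ind[OF T(1,2)]] SU(1) T(3) by (metis finite_Un)
    have "T \<subseteq> B"
    proof
      fix x assume x: "x \<in> T"
      show "x \<in> B"
      proof (rule ccontr)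
        assume nx: "x \<notin> B"
        \<comment> \<open>Exchanging \<open>x\<close> for \<open>w\<close> gives a member of the daisy that contains a vanishing sum.\<close>
        have "card (insert w (T - {x})) = t" using x w T t by (subst card_insert_disjoint) auto
        then have "independent2 f (S \<union> insert w (T - {x}))" using w T by (intro ind) auto
        moreover have "insert w B \<subseteq> S \<union> insert w (T - {x})" using B nx by auto
        moreover have "sum f (insert w B) = 0"
        proof -
          have "finite B" "w \<notin> B" using B SU T w finite_subset[of B "S \<union> T"] by auto
          then show ?thesis using B by (simp add: bit_vector_add_self)
        qed
        ultimately show False unfolding independent2_def by blast
      qed
    qed
    then show ?thesis using B by blast
  qed
  obtain B where B: "T \<subseteq> B" "B \<subseteq> S \<union> T" "sum f B = f u" using expand[OF uv(1)] by blast
  obtain C where C: "T \<subseteq> C" "C \<subseteq> S \<union> T" "sum f C = f v" using expand[OF uv(2)] by blast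
  have fin: "finite B" "finite C" using B C SU T finite_subset[of _ "S \<union> T"] by auto
  define E where "E = sym_diff B C"
  have E: "E \<subseteq> S" "finite E" unfolding E_def using B C fin by auto
  have "sum f E = f u + f v" unfolding E_def using fin B C by (simp add: sum_sym_diff)
  moreover have "u \<notin> E" "v \<notin> E" using E uv SU by auto
  ultimately have "sum f (insert u (insert v E)) = (f u + f v) + (f u + f v)"
    using E uv by (simp add: add.assoc)
  then have zero: "sum f (insert u (insert v E)) = 0" by (simp only: bit_vector_add_self)
  have "t - 2 \<le> card (U - {u, v})" using uv SU t by (subst card_Diff_subset) auto
  then obtain T' where T': "T' \<subseteq> U - {u, v}" "card T' = t - 2" "finite T'"
    by (meson obtain_subset_with_card_n)
  have "u \<notin> insert v T'" "v \<notin> T'" using T' uv by auto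
  then have "card (insert u (insert v T')) = t" using T' t by simp
  then have "independent2 f (S \<union> insert u (insert v T'))" using uv T' by (intro ind) auto
  moreover have "insert u (insert v E) \<subseteq> S \<union> insert u (insert v T')" using E by auto
  ultimately show False using zero unfolding independent2_def by blast
qed

section \<open>Random labellings\<close>

text \<open>Revealing the labels of \<open>A\<close> one at a time, a new label spoils independence only by hitting one
  of the at most \<open>2 ^ i\<close> subset sums of the first \<open>i\<close> labels. For a fixed subset \<open>B\<close>, the
  labellings with this defect make up a proportion at most \<open>1 / 2 ^ r\<close> of those independent so far,
  as the new label can be replaced by any vector and recovered afterwards from the labels on \<open>B\<close>.\<close>

lemma card_independent_labellings_ge:
  assumes "finite X" "A \<subseteq> X" "card A \<le> r"
  shows "(2 ^ r) ^ card X * (\<Prod>i<card A. 1 - 2 ^ i / 2 ^ r)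
    \<le> real (card {f \<in> X \<rightarrow>\<^sub>E bit_vectors r. independent2 f A})"
proof -
  have "finite A" using assms finite_subset by blast
  then show ?thesis using assms(2,3)
  proof (induction A rule: finite_induct)
    case empty
    have "{f \<in> X \<rightarrow>\<^sub>E bit_vectors r. independent2 f {}} = X \<rightarrow>\<^sub>E bit_vectors r"
      by (auto simp: independent2_def)
    then show ?case using assms(1) by (simp add: card_PiE card_bit_vectors)
  next
    case (insert a A)
    let ?L = "X \<rightarrow>\<^sub>E bit_vectors r"
    define G where "G = {f \<in> ?L. independent2 f A}"
    define bad where "bad B = {f \<in> G. f a = sum f B}" for B
    have finG: "finite G" unfolding G_def using assms(1) finite_bit_vectors by (simp add: finite_PiE)
    have bad: "real (card (bad B)) \<le> card G / 2 ^ r" if B: "B \<subseteq> A" for B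
    proof -
      let ?\<psi> = "\<lambda>(f, v). f(a := v)"
      have keep: "sum (f(a := v)) C = sum f C" if "C \<subseteq> A" for f :: "'a \<Rightarrow> nat \<Rightarrow> bit" and v C
        using that insert.hyps(2) by (intro sum.cong) auto
      have "inj_on ?\<psi> (bad B \<times> bit_vectors r)"
      proof (rule inj_on_inverseI[where g = "\<lambda>h. (h(a := sum h B), h a)"])
        fix p assume "p \<in> bad B \<times> bit_vectors r"
        then obtain f v where p: "p = (f, v)" "f \<in> bad B" by auto
        then have "f(a := sum f B) = f"
          unfolding bad_def by (metis (mono_tags, lifting) fun_upd_triv mem_Collect_eq)
        then show "((?\<psi> p)(a := sum (?\<psi> p) B), (?\<psi> p) a) = p" using p keep[OF B] by simp
      qed
      moreover have "?\<psi> ` (bad B \<times> bit_vectors r) \<subseteq> G"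
      proof clarify
        fix f v assume fv: "f \<in> bad B" "v \<in> bit_vectors r"
        then have f: "f \<in> ?L" "independent2 f A" unfolding bad_def G_def by auto
        have "independent2 (f(a := v)) A" using f(2) keep unfolding independent2_def by metis
        moreover have "f(a := v) \<in> ?L" using f(1) fv insert.prems by (auto simp: PiE_def extensional_def)
        ultimately show "f(a := v) \<in> G" unfolding G_def by simp
      qed
      ultimately have "card (bad B \<times> bit_vectors r) \<le> card G" by (rule card_inj_on_le) (rule finG)
      then have "real (card (bad B) * 2 ^ r) \<le> card G"
        by (simp add: card_cartesian_product card_bit_vectors del: of_nat_mult of_nat_power)
      then show ?thesis by (simp add: le_divide_eq)
    qed
    have "G - \<Union> (bad ` Pow A) \<subseteq> {f \<in> ?L. independent2 f (insert a A)}"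
    proof
      fix f assume f: "f \<in> G - \<Union> (bad ` Pow A)"
      have "B = {}" if B: "B \<subseteq> insert a A" "sum f B = 0" for B
      proof (cases "a \<in> B")
        case True
        have "finite B" using B insert.hyps finite_subset by blast
        then have "f a = sum f (B - {a})"
          using B True by (metis bit_vector_add_eq_0_iff sum.remove)
        then have "f \<in> bad (B - {a})" using f unfolding bad_def by auto
        moreover have "B - {a} \<in> Pow A" using B by auto
        ultimately show ?thesis using f by blast
      next
        case False
        then show ?thesis using B f unfolding G_def independent2_def by blast
      qed
      then show "f \<in> {f \<in> ?L. independent2 f (insert a A)}"
        using f unfolding G_def independent2_def by blast
    qed
    then have "card (G - \<Union> (bad ` Pow A)) \<le> card {f \<in> ?L. independent2 f (insert a A)}"
      by (rule card_mono[rotated]) (use assms(1) finite_bit_vectors in \<open>simp add: finite_PiE\<close>)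
    moreover have "card G - card (\<Union> (bad ` Pow A)) \<le> card (G - \<Union> (bad ` Pow A))"
      by (rule diff_card_le_card_Diff)
        (use insert.hyps finG in \<open>auto intro!: finite_subset[OF _ finG] simp: bad_def\<close>)
    moreover have "real (card (\<Union> (bad ` Pow A))) \<le> 2 ^ card A * (card G / 2 ^ r)"
    proof -
      have "card (\<Union> (bad ` Pow A)) \<le> (\<Sum>B\<in>Pow A. card (bad B))"
        using insert.hyps by (intro card_UN_le) auto
      then have "real (card (\<Union> (bad ` Pow A))) \<le> (\<Sum>B\<in>Pow A. real (card (bad B)))"
        by (metis of_nat_le_iff of_nat_sum)
      also have "\<dots> \<le> (\<Sum>B\<in>Pow A. card G / 2 ^ r)" using bad by (intro sum_mono) auto
      also have "\<dots> = 2 ^ card A * (card G / 2 ^ r)" using insert.hyps by (simp add: card_Pow)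
      finally show ?thesis .
    qed
    ultimately have *: "card G * (1 - 2 ^ card A / 2 ^ r)
        \<le> real (card {f \<in> ?L. independent2 f (insert a A)})"
      by (simp add: algebra_simps)
    have "card A \<le> r" using insert by simp
    then have "0 \<le> 1 - 2 ^ card A / (2 ^ r :: real)" by (simp add: power_increasing)
    moreover have "(2 ^ r) ^ card X * (\<Prod>i<card A. 1 - 2 ^ i / 2 ^ r) \<le> real (card G)"
      unfolding G_def using insert by simp
    ultimately have "(2 ^ r) ^ card X * (\<Prod>i<card A. 1 - 2 ^ i / 2 ^ r) * (1 - 2 ^ card A / 2 ^ r)
        \<le> card G * (1 - 2 ^ card A / (2 ^ r :: real))"
      by (rule mult_right_mono[rotated])
    with * show ?case using insert.hyps by (simp add: mult.assoc)
  qed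
qed

text \<open>The surplus \<open>1 / 2 ^ (r + 1)\<close> over \<open>1/4\<close> pays for the next factor of the product.\<close>

lemma prod_one_minus_half_powers_ge:
  assumes "r \<ge> 1"
  shows "1 / 4 + 1 / 2 ^ (r + 1) \<le> (\<Prod>k<r. 1 - 1 / 2 ^ (k + 1) :: real)"
  using assms
proof (induction r rule: dec_induct)
  case base
  show ?case by simp
next
  case (step r)
  define x :: real where "x = 1 / 2 ^ (r + 1)"
  have "(2 :: real) ^ 2 \<le> 2 ^ (r + 1)" using step by (intro power_increasing) auto
  then have x: "0 \<le> x" "x \<le> 1 / 4" by (simp_all add: x_def field_simps)
  have "(1 / 4 + x) * (1 - x) = 1 / 4 + x / 2 + x * (1 / 4 - x)" by (simp add: field_simps)
  then have "1 / 4 + x / 2 \<le> (1 / 4 + x) * (1 - x)" using x by simp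
  also have "\<dots> \<le> (\<Prod>k<r. 1 - 1 / 2 ^ (k + 1)) * (1 - x)"
    using step.IH x by (intro mult_right_mono) (simp_all add: x_def)
  finally show ?case by (simp add: x_def)
qed

lemma quarter_le_basis_probability:
  assumes "r \<ge> 1"
  shows "1 / 4 \<le> (\<Prod>i<r. 1 - 2 ^ i / 2 ^ r :: real)"
proof -
  have "(\<Prod>i<r. 1 - 2 ^ i / 2 ^ r :: real) = (\<Prod>k<r. 1 - 2 ^ (r - Suc k) / 2 ^ r)"
    by (rule prod.nat_diff_reindex[symmetric])
  also have "\<dots> = (\<Prod>k<r. 1 - 1 / 2 ^ (k + 1))"
    by (intro prod.cong) (auto simp: power_diff)
  finally have "1 / 4 + 1 / 2 ^ (r + 1) \<le> (\<Prod>i<r. 1 - 2 ^ i / 2 ^ r :: real)"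
    using prod_one_minus_half_powers_ge[OF assms] by simp
  moreover have "(0 :: real) \<le> 1 / 2 ^ (r + 1)" by simp
  ultimately show ?thesis by linarith
qed

text \<open>Averaging over all labellings finds one that keeps a quarter of the \<open>r\<close>-sets.\<close>

lemma quarter_choose_le_ex_daisy:
  assumes t: "2 \<le> t" "t \<le> r"
  shows "1 / 4 * real (n choose r) \<le> real (ex_daisy n r t)"
proof -
  define X where "X = {1..n}"
  define P where "P = {A. A \<subseteq> X \<and> card A = r}"
  define L where "L = X \<rightarrow>\<^sub>E bit_vectors r"
  have X: "finite X" "card X = n" by (simp_all add: X_def)
  have finP: "finite P" and cardP: "card P = n choose r"
    unfolding P_def using n_subsets[OF X(1)] X by auto
  have finL: "finite L" unfolding L_def using X finite_bit_vectors by (simp add: finite_PiE)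
  have cardL: "real (card L) = (2 ^ r) ^ n"
    unfolding L_def using X by (simp add: card_PiE card_bit_vectors)
  have kept: "card {A \<in> P. independent2 f A} \<le> ex_daisy n r t" if f: "f \<in> L" for f
  proof -
    have eq: "{A \<in> P. independent2 f A} = {A. A \<subseteq> X \<and> card A = r \<and> independent2 f A}"
      by (auto simp: P_def)
    have "daisy_free r t {A \<in> P. independent2 f A}"
      unfolding eq using f by (intro daisy_free_labelled_bases[OF t]) (auto simp: L_def)
    then show ?thesis
      using card_le_ex_daisy[of t X "{A \<in> P. independent2 f A}" r] t X by (auto simp: P_def)
  qed
  have "real (card P) * ((2 ^ r) ^ n * (1 / 4)) = (\<Sum>A\<in>P. (2 ^ r) ^ n * (1 / 4))" by simp
  also have "\<dots> \<le> (\<Sum>A\<in>P. real (card {f \<in> L. independent2 f A}))"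
  proof (rule sum_mono)
    fix A assume "A \<in> P"
    then have A: "A \<subseteq> X" "card A = r" by (auto simp: P_def)
    have "(2 ^ r) ^ n * (1 / 4 :: real) \<le> (2 ^ r) ^ n * (\<Prod>i<r. 1 - 2 ^ i / 2 ^ r)"
      using quarter_le_basis_probability[of r] t by (intro mult_left_mono) auto
    also have "\<dots> \<le> real (card {f \<in> L. independent2 f A})"
      using card_independent_labellings_ge[OF X(1) A(1), of r] A(2) X(2) unfolding L_def by simp
    finally show "(2 ^ r) ^ n * (1 / 4) \<le> real (card {f \<in> L. independent2 f A})" .
  qed
  also have "\<dots> = real (\<Sum>A\<in>P. card {f \<in> L. independent2 f A})" by simp
  also have "\<dots> = real (\<Sum>f\<in>L. card {A \<in> P. independent2 f A})"
    using sum_multicount_gen[OF finP finL, of "\<lambda>A f. independent2 f A"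
      "\<lambda>f. card {A \<in> P. independent2 f A}"] by simp
  also have "\<dots> \<le> real (\<Sum>f\<in>L. ex_daisy n r t)"
    using kept by (intro of_nat_mono sum_mono)
  also have "\<dots> = (2 ^ r) ^ n * real (ex_daisy n r t)" using cardL by simp
  finally show ?thesis using cardP by (simp add: mult.left_commute mult.commute)
qed

section \<open>The bounds on the density\<close>

lemma quarter_le_daisy_turan_density:
  assumes "2 \<le> t" "t \<le> r"
  shows "1 / 4 \<le> daisy_turan_density r t"
  using assms by (intro daisy_turan_density_ge quarter_choose_le_ex_daisy) auto

lemma powr_le_quarter:
  fixes x e :: real
  assumes "x \<ge> 3" "e \<ge> 0"
  shows "x powr (- e - 2 / sqrt (ln x)) \<le> 1 / 4"
proof -
  have "exp 1 \<le> x" using exp_le assms(1) by linarith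
  then have ln: "1 \<le> ln x" using assms(1) by (subst ln_ge_iff) auto
  have "ln x / sqrt (ln x) = sqrt (ln x)" using ln by (intro real_div_sqrt) auto
  then have "2 / sqrt (ln x) * ln x = 2 * sqrt (ln x)"
    by (metis times_divide_eq_left times_divide_eq_right)
  then have "(- e - 2 / sqrt (ln x)) * ln x = - (e * ln x) - 2 * sqrt (ln x)"
    by (simp only: left_diff_distrib mult_minus_left)
  also have "\<dots> \<le> - 2" using ln assms(2) real_sqrt_ge_one[OF ln] by (smt (verit) mult_nonneg_nonneg)
  finally have "x powr (- e - 2 / sqrt (ln x)) \<le> exp (- 2)"
    using assms(1) by (simp add: powr_def)
  moreover have "(4 :: real) \<le> exp 2"
  proof -
    have "(2 :: real) \<le> exp 1" using exp_ge_add_one_self[of 1] by simp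
    then have "(2 :: real) * 2 \<le> exp 1 * exp 1" by (intro mult_mono) auto
    then show ?thesis by (simp add: exp_add[symmetric])
  qed
  then have "exp (- 2 :: real) \<le> 1 / 4" by (simp add: exp_minus field_simps)
  ultimately show ?thesis by linarith
qed

theorem theorem1p4:
  shows "(\<exists>c::real. c > 0 \<and> (\<forall>r::nat. r \<ge> 2 \<longrightarrow> daisy_turan_density r 2 \<ge> c / real r)) \<and>
    (\<exists>C::real. C > 0 \<and> (\<forall>t::nat. t \<ge> 3 \<longrightarrow> (\<forall>r::nat. r \<ge> t \<longrightarrow>
       daisy_turan_density r t \<ge>
         real r powr (- ((4 * real t - 2) / (real ((2 * t) choose t) - 1)) - C / sqrt (ln (real r))))))"
proof (intro conjI)
  show "\<exists>c::real. c > 0 \<and> (\<forall>r::nat. r \<ge> 2 \<longrightarrow> daisy_turan_density r 2 \<ge> c / real r)"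
  proof (intro exI[of _ "1 / 4"] conjI allI impI)
    fix r :: nat assume r: "r \<ge> 2"
    have "1 / 4 / real r \<le> 1 / 4" using r by (simp add: field_simps)
    also have "\<dots> \<le> daisy_turan_density r 2" using r by (intro quarter_le_daisy_turan_density) auto
    finally show "1 / 4 / real r \<le> daisy_turan_density r 2" .
  qed simp
  show "\<exists>C::real. C > 0 \<and> (\<forall>t::nat. t \<ge> 3 \<longrightarrow> (\<forall>r::nat. r \<ge> t \<longrightarrow>
       daisy_turan_density r t \<ge>
         real r powr (- ((4 * real t - 2) / (real ((2 * t) choose t) - 1)) - C / sqrt (ln (real r)))))"
  proof (intro exI[of _ 2] conjI allI impI)
    fix t r :: nat assume tr: "t \<ge> 3" "r \<ge> t"
    have "1 \<le> (2 * t) choose t" by (simp add: Suc_leI)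
    then have "0 \<le> (4 * real t - 2) / (real ((2 * t) choose t) - 1)"
      using tr by (intro divide_nonneg_nonneg) auto
    then have "real r powr (- ((4 * real t - 2) / (real ((2 * t) choose t) - 1)) - 2 / sqrt (ln (real r)))
        \<le> 1 / 4"
      using tr by (intro powr_le_quarter) auto
    also have "\<dots> \<le> daisy_turan_density r t" using tr by (intro quarter_le_daisy_turan_density) auto
    finally show "real r powr (- ((4 * real t - 2) / (real ((2 * t) choose t) - 1)) - 2 / sqrt (ln (real r)))
        \<le> daisy_turan_density r t" .
  qed simp
qed

end
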